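(* Fix an integer $N\ge 2$. For every $t\in I=[0,1]$, every $n\in\mathbb{N}_+$ and every admissible block $(a_1,\ldots,a_n)$ of digits, $$\rho^t_N\big(R^n_N < x \,\big\vert\, a_1,\ldots,a_n\big)=\frac{Nx}{N-(1-x)(1-s^t_{N,n})},\qquad x\in I,$$ where the left-hand side is the $\rho^t_N$-conditional probability of the event $\{R^n_N<x\}$ given the cylinder $\{a_1(\cdot)=a_1,\ldots,a_n(\cdot)=a_n\}$.
   Context: Let $I=[0,1]$ with Borel $\sigma$-algebra $\mathcal{B}_I$. The Rényi-type map is $R_N:I\to I$, $R_N(x)=\frac{N}{1-x}-\lfloor\frac{N}{1-x}\rfloor$ for $x\neq 1$, $R_N(1)=0$. Its digits are $a_1(x)=\lfloor N/(1-x)\rfloor$ ($x\ne 1$), $a_1(1)=\infty$, and $a_n(x)=a_1(R_N^{n-1}(x))$ for $n\ge 2$; they take values in $\{N,N+1,\ldots\}$. A block $(a_1,\ldots,a_n)$ is admissible if some $x\in[0,1)$ has $a_i(x)=a_i$ for $1\le i\le n$. For $t\in I$, $\rho^t_N$ is the probability measure on $(I,\mathcal{B}_I)$ with distribution function $\rho^t_N([0,x])=\frac{Nx}{N-(1-x)(1-t)}$, $x\in I$. For $t\in I$ define $s^t_{N,0}=t$ and $s^t_{N,n}=1-\frac{N}{a_n+s^t_{N,n-1}}$ for $n\in\mathbb{N}_+$ (so $s^t_{N,n}$ depends on $a_1,\dots,a_n$). *)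

theory Defs
  imports "HOL-Probability.Probability" "HOL-Library.Extended_Nat"
begin

definition renyi_map :: "nat \<Rightarrow> real \<Rightarrow> real" where
  "renyi_map N x = (if x = 1 then 0 else real N / (1 - x) - of_int \<lfloor>real N / (1 - x)\<rfloor>)"

definition first_digit :: "nat \<Rightarrow> real \<Rightarrow> enat" where
  "first_digit N x = (if x = 1 then \<infinity> else enat (nat \<lfloor>real N / (1 - x)\<rfloor>))"

text \<open>Digits are indexed from 1; the value at index 0 is junk.\<close>

definition digit :: "nat \<Rightarrow> nat \<Rightarrow> real \<Rightarrow> enat" where
  "digit N n x = first_digit N ((renyi_map N ^^ (n - 1)) x)"

text \<open>A block \<open>(a\<^sub>1, \<dots>, a\<^sub>n)\<close> is represented by the values of a sequence \<open>a\<close> at the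
  indices \<open>1, \<dots>, n\<close>; its other values are irrelevant.\<close>

definition admissible :: "nat \<Rightarrow> nat \<Rightarrow> (nat \<Rightarrow> nat) \<Rightarrow> bool" where
  "admissible N n a \<longleftrightarrow> (\<exists>x\<in>{0..<1}. \<forall>i\<in>{1..n}. digit N i x = enat (a i))"

definition rho_cdf :: "nat \<Rightarrow> real \<Rightarrow> real \<Rightarrow> real" where
  "rho_cdf N t x = real N * x / (real N - (1 - x) * (1 - t))"

text \<open>The Lebesgue--Stieltjes measure of the distribution function, which is extended to the
  real line by 0 on the left and by 1 on the right of the unit interval.\<close>

definition rho :: "nat \<Rightarrow> real \<Rightarrow> real measure" where
  "rho N t = restrict_space (interval_measure (\<lambda>x. rho_cdf N t (max 0 (min 1 x)))) {0..1}"

fun s_seq :: "nat \<Rightarrow> real \<Rightarrow> (nat \<Rightarrow> nat) \<Rightarrow> nat \<Rightarrow> real" where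
  "s_seq N t a 0 = t"
| "s_seq N t a (Suc n) = 1 - real N / (real (a (Suc n)) + s_seq N t a n)"

lemma rho_denominator_pos:
  assumes "N \<ge> 2" "t \<in> {0..1}" "x \<in> {0..1}"
  shows "real N - (1 - x) * (1 - t) > 0"
proof -
  have "(1 - x) * (1 - t) \<le> 1 * 1"
    using assms by (intro mult_mono) auto
  with assms show ?thesis by simp
qed

lemma rho_cdf_mono:
  assumes "N \<ge> 2" "t \<in> {0..1}" "x \<in> {0..1}" "y \<in> {0..1}" "x \<le> y"
  shows "rho_cdf N t x \<le> rho_cdf N t y"
proof -
  have "x * (real N - (1 - t)) \<le> y * (real N - (1 - t))"
    using assms by (intro mult_right_mono) auto
  then have "x * (real N - (1 - y) * (1 - t)) \<le> y * (real N - (1 - x) * (1 - t))"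
    by (simp add: algebra_simps)
  then have "real N * (x * (real N - (1 - y) * (1 - t))) \<le> real N * (y * (real N - (1 - x) * (1 - t)))"
    by (intro mult_left_mono) auto
  then show ?thesis
    unfolding rho_cdf_def
    using rho_denominator_pos[of N t x] rho_denominator_pos[of N t y] assms
    by (subst frac_le_eq) (auto simp: divide_le_0_iff mult.assoc)
qed

lemma sets_rho [simp]: "sets (rho N t) = sets (restrict_space borel {0..1})"
  unfolding rho_def by (intro sets_restrict_space_cong) simp

lemma space_rho [simp]: "space (rho N t) = {0..1}"
  unfolding rho_def by (simp add: space_restrict_space)

lemma emeasure_rho_Icc:
  assumes N: "N \<ge> 2" and t: "t \<in> {0..1}" and x: "x \<in> {0..1}"
  shows "emeasure (rho N t) {0..x} = ennreal (rho_cdf N t x)"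
proof -
  let ?F = "\<lambda>x. rho_cdf N t (max 0 (min 1 x))"
  have cont: "continuous_on UNIV ?F"
    unfolding rho_cdf_def
  proof (intro continuous_intros ballI)
    fix z :: real
    show "real N - (1 - max 0 (min 1 z)) * (1 - t) \<noteq> 0"
      using rho_denominator_pos[OF N t, of "max 0 (min 1 z)"] by simp
  qed
  have mono: "?F u \<le> ?F v" if "u \<le> v" for u v :: real
    using that by (intro rho_cdf_mono[OF N t]) auto
  have "emeasure (rho N t) {0..x} = emeasure (interval_measure ?F) {0..x}"
    unfolding rho_def using x by (intro emeasure_restrict_space) auto
  also have "\<dots> = ennreal (?F x - ?F 0)"
    using x cont mono by (intro emeasure_interval_measure_Icc) auto
  also have "?F x - ?F 0 = rho_cdf N t x"
    using x by (simp add: rho_cdf_def)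
  finally show ?thesis .
qed

lemma prob_space_rho:
  assumes "N \<ge> 2" "t \<in> {0..1}"
  shows "prob_space (rho N t)"
  using emeasure_rho_Icc[OF assms, of 1] assms by (intro prob_spaceI) (simp add: rho_cdf_def)

lemma measure_rho_Icc:
  assumes "N \<ge> 2" "t \<in> {0..1}" "x \<in> {0..1}"
  shows "measure (rho N t) {0..x} = real N * x / (real N - (1 - x) * (1 - t))"
  using emeasure_rho_Icc[OF assms] rho_denominator_pos[OF assms] assms
  by (simp add: measure_def rho_cdf_def)

end

theory Submission
  imports Defs
begin

text \<open>
  The inverse branch of the Renyi-type map with digit \<open>a\<close> is \<open>u\<^sub>a z = 1 - N / (a + z)\<close>, an increasing
  full branch. Hence the event that the first \<open>n\<close> digits are \<open>a\<^sub>1, \<dots>, a\<^sub>n\<close> and the \<open>n\<close>-th iterate is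
  below \<open>x\<close> is the interval from \<open>v 0\<close> to \<open>v x\<close>, where \<open>v\<close> is the composition of the branches
  \<open>u\<close> with digits \<open>a\<^sub>1, \<dots>, a\<^sub>n\<close>. Writing \<open>F\<^sub>t\<close> for the distribution function with parameter \<open>t\<close>,
  the function \<open>F\<^sub>t \<circ> u\<^sub>a\<close> is an increasing affine function of \<open>F\<^sub>s\<close> with \<open>s = 1 - N / (a + t)\<close>.
  Iterating, \<open>F\<^sub>t \<circ> v\<close> is an increasing affine function of \<open>F\<^sub>s\<close> with \<open>s = s\<^sub>n\<close>, and
  conditioning on the cylinder normalises the affine coefficients away.
\<close>

definition renyi_branch :: "nat \<Rightarrow> nat \<Rightarrow> real \<Rightarrow> real" where
  "renyi_branch N k z = 1 - real N / (real k + z)"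

text \<open>The newest digit acts innermost, so appending a digit splits off the last step of the
  orbit, in parallel with the recursion of \<open>s_seq\<close>.\<close>

fun renyi_branches :: "nat \<Rightarrow> (nat \<Rightarrow> nat) \<Rightarrow> nat \<Rightarrow> real \<Rightarrow> real" where
  "renyi_branches N a 0 z = z"
| "renyi_branches N a (Suc n) z = renyi_branches N a n (renyi_branch N (a (Suc n)) z)"

lemma renyi_map_nonneg: "0 \<le> renyi_map N x"
  unfolding renyi_map_def by auto

lemma renyi_map_less_1: "renyi_map N x < 1"
  unfolding renyi_map_def by (auto intro: frac_lt_1[unfolded frac_def])

lemma renyi_map_funpow_mem:
  assumes "y \<in> {0..1}"
  shows "(renyi_map N ^^ n) y \<in> {0..1}"
  using assms by (cases n) (auto simp: renyi_map_nonneg less_imp_le[OF renyi_map_less_1])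

lemma renyi_branch_mem:
  assumes "1 \<le> N" "N \<le> k" "z \<in> {0..1}"
  shows "renyi_branch N k z \<in> {0..1}"
  using assms by (auto simp: renyi_branch_def field_simps)

lemma renyi_branch_mono:
  assumes "1 \<le> N" "N \<le> k" "0 \<le> z" "z \<le> w"
  shows "renyi_branch N k z \<le> renyi_branch N k w"
  using assms by (auto simp: renyi_branch_def intro!: divide_left_mono)

lemma renyi_branches_mem:
  assumes "1 \<le> N" "\<forall>i\<in>{1..n}. N \<le> a i" "z \<in> {0..1}"
  shows "renyi_branches N a n z \<in> {0..1}"
  using assms
proof (induction n arbitrary: z)
  case (Suc n)
  then show ?case using renyi_branch_mem[of N "a (Suc n)" z] by auto
qed simp

lemma renyi_branches_mono:
  assumes "1 \<le> N" "\<forall>i\<in>{1..n}. N \<le> a i" "z \<in> {0..1}" "w \<in> {0..1}" "z \<le> w"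
  shows "renyi_branches N a n z \<le> renyi_branches N a n w"
  using assms
proof (induction n arbitrary: z w)
  case (Suc n)
  then show ?case
    using renyi_branch_mem[of N "a (Suc n)" z] renyi_branch_mem[of N "a (Suc n)" w]
      renyi_branch_mono[of N "a (Suc n)" z w] by auto
qed simp

lemma first_digit_and_renyi_map_less_iff:
  assumes "1 \<le> N" "N \<le> k" "z \<in> {0..1}" "x \<in> {0..1}"
  shows "first_digit N z = enat k \<and> renyi_map N z < x \<longleftrightarrow>
    renyi_branch N k 0 \<le> z \<and> z < renyi_branch N k x"
proof (cases "z = 1")
  \<comment> \<open>The digit of 1 is infinite, and no branch value exceeds 1, so both sides are
    false.\<close>
  case True
  then show ?thesis using assms renyi_branch_mem[of N k x] by (auto simp: first_digit_def)
next
  case False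
  define q where "q = real N / (1 - z)"
  have z: "0 < 1 - z" using False assms by auto
  have q: "0 < q" unfolding q_def using z assms by simp
  have "first_digit N z = enat k \<longleftrightarrow> \<lfloor>q\<rfloor> = int k"
    using False q assms by (auto simp: first_digit_def q_def[symmetric])
  moreover have "renyi_map N z = q - of_int \<lfloor>q\<rfloor>"
    using False by (simp add: renyi_map_def q_def)
  ultimately have "first_digit N z = enat k \<and> renyi_map N z < x \<longleftrightarrow>
      \<lfloor>q\<rfloor> = int k \<and> q < real k + x"
    by auto
  \<comment> \<open>As \<open>x\<close> is at most 1, the bound \<open>q < real k + x\<close>
    already gives the upper half of the floor condition.\<close>
  also have "\<dots> \<longleftrightarrow> real k \<le> q \<and> q < real k + x"
    using assms(4) by (auto simp: floor_eq_iff)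
  also have "real k \<le> q \<longleftrightarrow> renyi_branch N k 0 \<le> z"
    using z assms by (auto simp: q_def renyi_branch_def field_simps)
  also have "q < real k + x \<longleftrightarrow> z < renyi_branch N k x"
    using z assms by (auto simp: q_def renyi_branch_def field_simps)
  finally show ?thesis .
qed

text \<open>Induction that peels off the last digit: the conditions on digit \<open>Suc n\<close>
  and on the next iterate together confine the \<open>n\<close>-th iterate to a half-open
  interval.\<close>

lemma renyi_cylinder_eq_Ico:
  assumes "1 \<le> N" "\<forall>i\<in>{1..n}. N \<le> a i" "x \<in> {0..1}"
  shows "{y\<in>{0..1}. (\<forall>i\<in>{1..n}. digit N i y = enat (a i)) \<and> (renyi_map N ^^ n) y < x}
    = {renyi_branches N a n 0..<renyi_branches N a n x}"
  using assms
proof (induction n arbitrary: x)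
  case (Suc n)
  define E where
    "E w = {y\<in>{0..1}. (\<forall>i\<in>{1..n}. digit N i y = enat (a i)) \<and> (renyi_map N ^^ n) y < w}" for w
  let ?u = "renyi_branch N (a (Suc n))"
  have a: "N \<le> a (Suc n)" "\<forall>i\<in>{1..n}. N \<le> a i" using Suc.prems by auto
  have u: "?u 0 \<in> {0..1}" "?u x \<in> {0..1}"
    using renyi_branch_mem[OF Suc.prems(1) a(1)] Suc.prems(3) by auto
  have "{y\<in>{0..1}. (\<forall>i\<in>{1..Suc n}. digit N i y = enat (a i)) \<and> (renyi_map N ^^ Suc n) y < x}
      = E (?u x) - E (?u 0)"
  proof (intro set_eqI)
    fix y
    have "first_digit N ((renyi_map N ^^ n) y) = enat (a (Suc n))
        \<and> renyi_map N ((renyi_map N ^^ n) y) < x \<longleftrightarrow>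
        ?u 0 \<le> (renyi_map N ^^ n) y \<and> (renyi_map N ^^ n) y < ?u x" if "y \<in> {0..1}"
      using that Suc.prems a
      by (intro first_digit_and_renyi_map_less_iff renyi_map_funpow_mem) auto
    then show "y \<in> {y\<in>{0..1}. (\<forall>i\<in>{1..Suc n}. digit N i y = enat (a i))
        \<and> (renyi_map N ^^ Suc n) y < x} \<longleftrightarrow> y \<in> E (?u x) - E (?u 0)"
      unfolding E_def by (auto simp: atLeastAtMostSuc_conv digit_def)
  qed
  \<comment> \<open>By induction both sets are intervals with left end
    \<open>renyi_branches N a n 0\<close>; monotonicity puts this end below the cut at
    \<open>?u 0\<close>.\<close>
  also have "\<dots> = {renyi_branches N a n (?u 0)..<renyi_branches N a n (?u x)}"
    using Suc.IH[OF Suc.prems(1) a(2) u(1)] Suc.IH[OF Suc.prems(1) a(2) u(2)]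
      renyi_branches_mono[OF Suc.prems(1) a(2), of 0 "?u 0"] u
    by (auto simp: E_def)
  finally show ?case by simp
qed auto

text \<open>Both distribution functions, as functions of \<open>z\<close>, are fractional linear
  with the same pole \<open>1 - k - t\<close>, hence affinely related.\<close>

lemma rho_cdf_renyi_branch:
  assumes "2 \<le> N" "N \<le> k" "t \<in> {0..1}"
  obtains A B where "B > 0" and
    "\<And>z. z \<in> {0..1} \<Longrightarrow>
      rho_cdf N t (renyi_branch N k z) = A + B * rho_cdf N (1 - real N / (real k + t)) z"
proof
  \<comment> \<open>\<open>A\<close> is the value of the left-hand side at \<open>z = 0\<close>, and
    \<open>B\<close> is its increment from 0 to 1, that is, the mass of the cylinder of digit
    \<open>k\<close>.\<close>
  define A where "A = (real k - N) / (real k - 1 + t)"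
  define B where "B = (real N - 1 + t) / ((real k - 1 + t) * (real k + t))"
  show "B > 0" unfolding B_def using assms by (intro divide_pos_pos mult_pos_pos) auto
  fix z :: real assume z: "z \<in> {0..1}"
  have p: "real k + z > 0" "real k + t > 0" "real k - 1 + t > 0" "real k - 1 + t + z > 0"
    "real N > 0"
    using assms z by auto
  have "rho_cdf N t (renyi_branch N k z)
      = real N * ((real k + z - N) / (real k + z)) / (real N * ((real k - 1 + t + z) / (real k + z)))"
    unfolding rho_cdf_def renyi_branch_def using p
    by (intro arg_cong2[where f="(/)"]) (simp_all add: field_simps)
  also have "\<dots> = (real k + z - N) / (real k - 1 + t + z)"
    using p by simp
  finally have 1: "rho_cdf N t (renyi_branch N k z) = (real k + z - N) / (real k - 1 + t + z)" .
  have "rho_cdf N (1 - real N / (real k + t)) z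
      = real N * z / (real N * ((real k - 1 + t + z) / (real k + t)))"
    unfolding rho_cdf_def using p
    by (intro arg_cong2[where f="(/)"]) (simp_all add: field_simps)
  also have "\<dots> = z * (real k + t) / (real k - 1 + t + z)"
    using p by simp
  finally have 2: "B * rho_cdf N (1 - real N / (real k + t)) z
      = (real N - 1 + t) * z / ((real k - 1 + t) * (real k - 1 + t + z))"
    unfolding B_def using p by simp
  show "rho_cdf N t (renyi_branch N k z) = A + B * rho_cdf N (1 - real N / (real k + t)) z"
    unfolding 1 2 A_def using p(3,4)
    by (simp add: divide_simps) (simp add: algebra_simps)
qed

text \<open>Each step of \<open>s_seq\<close> applies the branch of the new digit to the previous
  value, and branches preserve the unit interval.\<close>

lemma s_seq_mem:
  assumes "1 \<le> N" "t \<in> {0..1}" "\<forall>i\<in>{1..n}. N \<le> a i"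
  shows "s_seq N t a n \<in> {0..1}"
  using assms
proof (induction n)
  case (Suc n)
  then show ?case
    using renyi_branch_mem[of N "a (Suc n)" "s_seq N t a n"] by (auto simp: renyi_branch_def)
qed simp

lemma rho_cdf_renyi_branches:
  assumes "2 \<le> N" "t \<in> {0..1}" "\<forall>i\<in>{1..n}. N \<le> a i"
  shows "\<exists>A B. B > 0 \<and> (\<forall>z\<in>{0..1}.
    rho_cdf N t (renyi_branches N a n z) = A + B * rho_cdf N (s_seq N t a n) z)"
  using assms
proof (induction n)
  case 0
  show ?case by (intro exI[of _ 0] exI[of _ 1]) simp
next
  case (Suc n)
  then obtain A B where AB: "B > 0"
    "\<And>z. z \<in> {0..1} \<Longrightarrow>
      rho_cdf N t (renyi_branches N a n z) = A + B * rho_cdf N (s_seq N t a n) z"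
    by auto
  have a: "N \<le> a (Suc n)" using Suc.prems by auto
  have s: "s_seq N t a n \<in> {0..1}" using Suc.prems by (intro s_seq_mem) auto
  obtain C D where CD: "D > 0"
    "\<And>z. z \<in> {0..1} \<Longrightarrow> rho_cdf N (s_seq N t a n) (renyi_branch N (a (Suc n)) z)
      = C + D * rho_cdf N (s_seq N t a (Suc n)) z"
    using rho_cdf_renyi_branch[OF Suc.prems(1) a s, folded s_seq.simps(2)] by blast
  have "rho_cdf N t (renyi_branches N a (Suc n) z)
      = (A + B * C) + B * D * rho_cdf N (s_seq N t a (Suc n)) z" if "z \<in> {0..1}" for z
    using AB(2)[OF renyi_branch_mem[OF _ a that]] CD(2)[OF that] Suc.prems(1)
    by (simp add: algebra_simps)
  then show ?case using AB(1) CD(1) by (metis mult_pos_pos)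
qed

lemma measure_rho_Icc_diff:
  assumes N: "2 \<le> N" and t: "t \<in> {0..1}" and cd: "0 \<le> c" "c \<le> d" "d \<le> 1"
  shows "measure (rho N t) {c..d} = rho_cdf N t d - rho_cdf N t c"
proof -
  let ?F = "\<lambda>x. rho_cdf N t (max 0 (min 1 x))"
  have cont: "continuous_on UNIV ?F"
    unfolding rho_cdf_def
  proof (intro continuous_intros ballI)
    fix z :: real
    show "real N - (1 - max 0 (min 1 z)) * (1 - t) \<noteq> 0"
      using rho_denominator_pos[OF N t, of "max 0 (min 1 z)"] by simp
  qed
  have mono: "?F u \<le> ?F v" if "u \<le> v" for u v :: real
    using that by (intro rho_cdf_mono[OF N t]) auto
  have "emeasure (rho N t) {c..d} = emeasure (interval_measure ?F) {c..d}"
    unfolding rho_def using cd by (intro emeasure_restrict_space) auto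
  also have "\<dots> = ennreal (?F d - ?F c)"
    using cd cont mono by (intro emeasure_interval_measure_Icc) auto
  finally show ?thesis using mono[OF cd(2)] cd by (simp add: measure_def)
qed

text \<open>The right endpoint has mass zero, by the closed-interval formula with both ends equal to
  \<open>d\<close>.\<close>

lemma measure_rho_Ico:
  assumes N: "2 \<le> N" and t: "t \<in> {0..1}" and cd: "0 \<le> c" "c \<le> d" "d \<le> 1"
  shows "measure (rho N t) {c..<d} = rho_cdf N t d - rho_cdf N t c"
proof -
  interpret prob_space "rho N t" using N t by (rule prob_space_rho)
  have sets: "{u..v} \<in> sets (rho N t)" if "0 \<le> u" "v \<le> 1" for u v
    using that by (auto simp: sets_restrict_space_iff)
  have "{c..<d} = {c..d} - {d..d}" by auto
  then have "measure (rho N t) {c..<d} = measure (rho N t) {c..d} - measure (rho N t) {d..d}"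
    using sets[of c d] sets[of d d] cd by (simp only:) (rule finite_measure_Diff, auto)
  then show ?thesis
    using measure_rho_Icc_diff[OF N t cd] measure_rho_Icc_diff[OF N t, of d d] cd by simp
qed

text \<open>A finite digit keeps the iterate \<open>z\<close> away from 1, and then
  \<open>1 - z\<close> lies in (0,1], so that \<open>N / (1 - z)\<close> is at least
  \<open>N\<close>.\<close>

lemma admissible_digit_ge:
  assumes "admissible N n a" "i \<in> {1..n}"
  shows "N \<le> a i"
proof -
  obtain y where y: "y \<in> {0..<1}" "digit N i y = enat (a i)"
    using assms by (auto simp: admissible_def)
  define z where "z = (renyi_map N ^^ (i - 1)) y"
  have z: "z \<in> {0..1}" unfolding z_def using y by (intro renyi_map_funpow_mem) auto
  have d: "first_digit N z = enat (a i)" using y by (simp add: digit_def z_def)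
  then have "z \<noteq> 1" by (auto simp: first_digit_def)
  then have "real N \<le> real N / (1 - z)"
    using z by (simp add: le_divide_eq) (simp add: algebra_simps)
  then have "int N \<le> \<lfloor>real N / (1 - z)\<rfloor>" by (simp add: le_floor_iff)
  then show ?thesis using d \<open>z \<noteq> 1\<close> by (auto simp: first_digit_def)
qed

theorem theorem2p5:
  fixes N n :: nat and t x :: real and a :: "nat \<Rightarrow> nat"
  assumes "N \<ge> 2"
    and "t \<in> {0..1}"
    and "n \<ge> 1"
    and "admissible N n a"
    and "x \<in> {0..1}"
  shows "\<P>(y in rho N t. (renyi_map N ^^ n) y < x \<bar> \<forall>i\<in>{1..n}. digit N i y = enat (a i))
    = real N * x / (real N - (1 - x) * (1 - s_seq N t a n))"
proof -
  let ?v = "renyi_branches N a n" and ?s = "s_seq N t a n"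
  have N1: "1 \<le> N" using assms(1) by simp
  have a: "\<forall>i\<in>{1..n}. N \<le> a i" using admissible_digit_ge[OF assms(4)] by blast
  obtain A B where "B > 0"
    and AB: "\<And>z. z \<in> {0..1} \<Longrightarrow> rho_cdf N t (?v z) = A + B * rho_cdf N ?s z"
    using rho_cdf_renyi_branches[OF assms(1,2) a] by blast
  \<comment> \<open>The offset \<open>A\<close> cancels in the difference of endpoint values, since
    \<open>rho_cdf\<close> vanishes at 0.\<close>
  have meas: "measure (rho N t)
      {y\<in>{0..1}. (\<forall>i\<in>{1..n}. digit N i y = enat (a i)) \<and> (renyi_map N ^^ n) y < w}
      = B * rho_cdf N ?s w" if w: "w \<in> {0..1}" for w
  proof -
    have "measure (rho N t) {?v 0..<?v w} = rho_cdf N t (?v w) - rho_cdf N t (?v 0)"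
      using renyi_branches_mem[OF N1 a, of 0] renyi_branches_mem[OF N1 a w]
        renyi_branches_mono[OF N1 a, of 0 w] w
      by (intro measure_rho_Ico[OF assms(1,2)]) auto
    also have "\<dots> = B * rho_cdf N ?s w"
      using AB[OF w] AB[of 0] by (simp add: rho_cdf_def)
    finally show ?thesis using renyi_cylinder_eq_Ico[OF N1 a w] by simp
  qed
  \<comment> \<open>For \<open>n \<ge> 1\<close> the iterate is a value of the map, hence below 1.
    The event with \<open>w = 1\<close> is therefore the whole cylinder, whose mass is
    \<open>B\<close>.\<close>
  have "(renyi_map N ^^ n) y < 1" for y
    using assms(3) by (cases n) (auto simp: renyi_map_less_1)
  then have cyl: "measure (rho N t) {y\<in>{0..1}. \<forall>i\<in>{1..n}. digit N i y = enat (a i)} = B"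
    using meas[of 1] N1 by (simp add: rho_cdf_def)
  have "\<P>(y in rho N t. (renyi_map N ^^ n) y < x \<bar> \<forall>i\<in>{1..n}. digit N i y = enat (a i))
      = B * rho_cdf N ?s x / B"
    unfolding cond_prob_def space_rho using meas[OF assms(5)] cyl by (simp only: conj_commute)
  \<comment> \<open>The cylinder has positive mass, so the quotient is a genuine one and
    \<open>B\<close> cancels.\<close>
  then show ?thesis using \<open>B > 0\<close> by (simp add: rho_cdf_def)
qed

end
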